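(* Let $A,\Pi_1,\Pi_2\subset\mathbb{R}\setminus\{0\}$ be finite sets with $|\Pi_1|,|\Pi_2|\geq|A|$. \begin{enumerate} \item[(i)] If $T\geq1$ is such that $r_{\Pi_1\Pi_2}(a)\geq T$ for all $a\in A$, then \[ |A+A|^{19}|\Pi_1|^{22}|\Pi_2|^{22}\gg |A|^{41}T^{33}(\log|A|)^{-23}\,. \] \item[(ii)] If $A$ is a convex set, then \[ |A+A|\gg |A|^{30/19}(\log|A|)^{-23/19}\,. \] \end{enumerate}
   Context: $r_{\Pi_1\Pi_2}(a)=|\{(p,q)\in\Pi_1\times\Pi_2: pq=a\}|$; $A+A=\{a+b:a,b\in A\}$. A finite set $A=\{a_1<\dots<a_n\}\subseteq\mathbb{R}$ is convex if $a_{i+1}-a_i$ is strictly increasing in $i$. $X\gg Y$ means $X\geq cY$ for an absolute constant $c>0$. $|A|$ is assumed to exceed a sufficiently large absolute constant. *)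

theory Defs
  imports Complex_Main "HOL-Library.Set_Algebras"
begin

definition mult_reps :: "real set \<Rightarrow> real set \<Rightarrow> real \<Rightarrow> nat" where
  "mult_reps P Q a = card {(p, q). p \<in> P \<and> q \<in> Q \<and> p * q = a}"

text \<open>Convexity in the additive-combinatorial sense for finite sets of reals; unrelated to
  the constant \<open>convex\<close> for subsets of a vector space.\<close>

definition convex_fin_set :: "real set \<Rightarrow> bool" where
  "convex_fin_set A \<longleftrightarrow>
     (\<exists>(n :: nat) (a :: nat \<Rightarrow> real).
        A = a ` {1..n} \<and> strict_mono_on {1..n} a \<and>
        strict_mono_on {1..<n} (\<lambda>i. a (i + 1) - a i))"

end

theory Submission
  imports Defs "HOL-Analysis.Harmonic_Numbers" "HOL-Library.Discrete_Functions"
begin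

text \<open>
  Both parts are instances of one statement about a grid of values \<open>g p q\<close> in which every row is
  monotone in \<open>q\<close> and two rows have no common increment: \<open>g p q = p q\<close> for products, and
  \<open>g p q = a (q - p)\<close> for a convex set, where every element has \<open>T = |A|\<close> representations.
  The translates \<open>x = g p q - b\<close> are pseudolines, and since the points form a Cartesian product, the
  Szemeredi--Trotter bound for them needs no cell decomposition: cut \<open>Q\<close> and \<open>X\<close> into consecutive
  blocks; a monotone curve meets few of the resulting boxes, and two points in a box lie on at most
  one curve. This bounds the number of \<open>t\<close>-rich differences in \<open>A - B\<close> by a multiple of
  \<open>(|P| |Q| |B|)\<^sup>2 / (T t)\<^sup>3\<close>, so that the third moment \<open>\<Sum>x. r\<^bsub>A-B\<^esub>(x)\<^sup>3\<close> is at most \<open>M |B|\<^sup>2\<close> for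
  every finite \<open>B\<close>, with \<open>M\<close> of order \<open>(|P| |Q|)\<^sup>2 T\<^sup>-\<^sup>3 log |A|\<close>.

  To see that such moments force \<open>A + A\<close> to be large, keep the core of those \<open>a \<in> A\<close> for which most
  sums \<open>a + c\<close> are popular, and let \<open>D\<close> be the set of differences in the core whose popularity is at
  least the dyadic value \<open>\<delta>\<close> that dominates its energy. Mapping the triples \<open>(a, b, c)\<close> with
  \<open>a - b \<in> D\<close> to \<open>(a + c, b + c)\<close>, Cauchy--Schwarz and the third moment of \<open>A - A\<close> give many pairs
  of popular sums with difference in \<open>D\<close>. Each of them yields \<open>|A|\<^sup>2 / (8 |A + A|)\<close> solutions of
  \<open>a - x = z - c\<close> with \<open>x \<in> D\<close> and \<open>z\<close> a popular sum, whose number is bounded from above by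
  Hoelder's inequality and the third moments of \<open>A - D\<close> and of popular sums minus \<open>A\<close>.
\<close>

subsection \<open>Finite sums and counting\<close>

lemma sum_power2_le_mult_sum:
  fixes a b c :: "'i \<Rightarrow> real"
  assumes "\<And>i. i \<in> I \<Longrightarrow> 0 \<le> a i" "\<And>i. i \<in> I \<Longrightarrow> 0 \<le> b i"
    and "\<And>i. i \<in> I \<Longrightarrow> (c i)\<^sup>2 \<le> a i * b i"
  shows "(\<Sum>i\<in>I. c i)\<^sup>2 \<le> (\<Sum>i\<in>I. a i) * (\<Sum>i\<in>I. b i)"
proof -
  have "\<bar>c i\<bar> \<le> sqrt (a i) * sqrt (b i)" if "i \<in> I" for i
    using real_sqrt_le_mono[OF assms(3)[OF that]] by (simp add: real_sqrt_mult)
  then have "\<bar>\<Sum>i\<in>I. c i\<bar> \<le> (\<Sum>i\<in>I. sqrt (a i) * sqrt (b i))"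
    by (rule order.trans[OF sum_abs sum_mono])
  then have "(\<Sum>i\<in>I. c i)\<^sup>2 \<le> (\<Sum>i\<in>I. sqrt (a i) * sqrt (b i))\<^sup>2"
    by (rule abs_le_square_iff[THEN iffD1, OF order.trans]) simp
  also have "\<dots> \<le> (\<Sum>i\<in>I. (sqrt (a i))\<^sup>2) * (\<Sum>i\<in>I. (sqrt (b i))\<^sup>2)"
    by (rule Cauchy_Schwarz_ineq_sum)
  also have "\<dots> = (\<Sum>i\<in>I. a i) * (\<Sum>i\<in>I. b i)"
    using assms by simp
  finally show ?thesis .
qed

lemma sum_mult_power2_power3_le:
  fixes f g :: "'i \<Rightarrow> real"
  assumes "\<And>i. i \<in> I \<Longrightarrow> 0 \<le> f i" "\<And>i. i \<in> I \<Longrightarrow> 0 \<le> g i"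
  shows "(\<Sum>i\<in>I. f i * g i ^ 2) ^ 3 \<le> (\<Sum>i\<in>I. f i ^ 3) * (\<Sum>i\<in>I. g i ^ 3)\<^sup>2"
    (is "?u ^ 3 \<le> ?F * ?G\<^sup>2")
proof (cases "?u = 0")
  case True
  then show ?thesis using assms by (simp add: sum_nonneg)
next
  case False
  \<comment> \<open>Two applications of Cauchy--Schwarz replace Hoelder's inequality.\<close>
  define v where "v = (\<Sum>i\<in>I. f i ^ 2 * g i)"
  have u: "?u\<^sup>2 \<le> v * ?G" and v: "v\<^sup>2 \<le> ?F * ?u"
    unfolding v_def using assms
    by (intro sum_power2_le_mult_sum; auto simp: power2_eq_square power3_eq_cube mult_ac)+
  have "?u * ?u ^ 3 = (?u\<^sup>2)\<^sup>2" by (simp add: power2_eq_square power3_eq_cube)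
  also have "\<dots> \<le> (v * ?G)\<^sup>2" using u by (intro power_mono) auto
  also have "\<dots> = v\<^sup>2 * ?G\<^sup>2" by (rule power_mult_distrib)
  also have "\<dots> \<le> ?F * ?u * ?G\<^sup>2" using v by (intro mult_right_mono) auto
  finally have "?u * ?u ^ 3 \<le> ?u * (?F * ?G\<^sup>2)" by (simp add: mult_ac)
  moreover have "0 \<le> ?u" using assms by (intro sum_nonneg) auto
  ultimately show ?thesis using False by (simp add: mult_le_cancel_left)
qed

lemma sum_mult_power6_le:
  fixes f g :: "'i \<Rightarrow> real"
  assumes "\<And>i. i \<in> I \<Longrightarrow> 0 \<le> f i" "\<And>i. i \<in> I \<Longrightarrow> 0 \<le> g i"
  shows "(\<Sum>i\<in>I. f i * g i) ^ 6 \<le> (\<Sum>i\<in>I. f i) ^ 3 * ((\<Sum>i\<in>I. f i ^ 3) * (\<Sum>i\<in>I. g i ^ 3)\<^sup>2)"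
proof -
  let ?u = "\<Sum>i\<in>I. f i * g i ^ 2"
  have "(\<Sum>i\<in>I. f i * g i)\<^sup>2 \<le> (\<Sum>i\<in>I. f i) * ?u"
    using assms by (intro sum_power2_le_mult_sum) (auto simp: power2_eq_square mult_ac)
  then have "((\<Sum>i\<in>I. f i * g i)\<^sup>2) ^ 3 \<le> ((\<Sum>i\<in>I. f i) * ?u) ^ 3"
    by (intro power_mono) auto
  also have "\<dots> = (\<Sum>i\<in>I. f i) ^ 3 * ?u ^ 3" by (rule power_mult_distrib)
  also have "\<dots> \<le> (\<Sum>i\<in>I. f i) ^ 3 * ((\<Sum>i\<in>I. f i ^ 3) * (\<Sum>i\<in>I. g i ^ 3)\<^sup>2)"
    using assms by (intro mult_left_mono sum_mult_power2_power3_le) (auto intro: sum_nonneg)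
  finally show ?thesis by simp
qed

lemma card_eq_sum_card_fibres:
  assumes "finite S" "finite Y" "f ` S \<subseteq> Y"
  shows "card S = (\<Sum>y\<in>Y. card {u \<in> S. f u = y})"
  using sum_fun_comp[OF assms, of "\<lambda>_. 1::nat"] by simp

definition coincidences :: "('u \<Rightarrow> 'y) \<Rightarrow> 'u set \<Rightarrow> ('v \<Rightarrow> 'y) \<Rightarrow> 'v set \<Rightarrow> ('u \<times> 'v) set" where
  "coincidences f S g T = {(u, v). u \<in> S \<and> v \<in> T \<and> f u = g v}"

lemma finite_coincidences:
  assumes "finite S" "finite T" shows "finite (coincidences f S g T)"
  by (rule finite_subset[of _ "S \<times> T"]) (use assms in \<open>auto simp: coincidences_def\<close>)

lemma card_coincidences:
  assumes "finite S" "finite T" "finite Y" "f ` S \<subseteq> Y"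
  shows "card (coincidences f S g T)
    = (\<Sum>y\<in>Y. card {u \<in> S. f u = y} * card {v \<in> T. g v = y})"
proof -
  have "coincidences f S g T = (SIGMA u:S. {v \<in> T. g v = f u})"
    by (auto simp: coincidences_def)
  then show ?thesis
    using assms sum_fun_comp[OF assms(1,3,4), of "\<lambda>y. card {v \<in> T. g v = y}"] by simp
qed

lemma card_power2_le_card_mult_coincidences:
  assumes "finite S" "finite Y" "f ` S \<subseteq> Y"
  shows "(card S)\<^sup>2 \<le> card Y * card (coincidences f S f S)"
proof -
  have "(\<Sum>y\<in>Y. real (card {u \<in> S. f u = y}))\<^sup>2
      \<le> (\<Sum>y\<in>Y. 1) * (\<Sum>y\<in>Y. (real (card {u \<in> S. f u = y}))\<^sup>2)"
    by (intro sum_power2_le_mult_sum) auto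
  then have "real ((card S)\<^sup>2) \<le> real (card Y * card (coincidences f S f S))"
    unfolding card_coincidences[OF assms(1) assms] card_eq_sum_card_fibres[OF assms]
    by (simp add: power2_eq_square)
  then show ?thesis by (simp only: of_nat_le_iff)
qed

lemma card_le_card_image_plus_collisions:
  assumes "finite G"
  shows "card G \<le> card (\<kappa> ` G) + card {(u, v). u \<in> G \<and> v \<in> G \<and> u \<noteq> v \<and> \<kappa> u = \<kappa> v}"
proof -
  define rep where "rep = inv_into G \<kappa>"
  have rep: "rep (\<kappa> u) \<in> G" "\<kappa> (rep (\<kappa> u)) = \<kappa> u" if "u \<in> G" for u
    unfolding rep_def using that by (auto intro: inv_into_into f_inv_into_f)
  let ?R = "rep ` \<kappa> ` G"
  have "card G \<le> card (?R \<union> (G - ?R))" using assms by (intro card_mono) auto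
  also have "\<dots> \<le> card ?R + card (G - ?R)" by (rule card_Un_le)
  also have "card ?R \<le> card (\<kappa> ` G)" using assms by (intro card_image_le) auto
  also have "card (G - ?R) \<le> card {(u, v). u \<in> G \<and> v \<in> G \<and> u \<noteq> v \<and> \<kappa> u = \<kappa> v}"
  proof (rule card_inj_on_le)
    show "inj_on (\<lambda>u. (u, rep (\<kappa> u))) (G - ?R)" by (auto intro: inj_onI)
    show "(\<lambda>u. (u, rep (\<kappa> u))) ` (G - ?R) \<subseteq> {(u, v). u \<in> G \<and> v \<in> G \<and> u \<noteq> v \<and> \<kappa> u = \<kappa> v}"
      using rep by auto
    show "finite {(u, v). u \<in> G \<and> v \<in> G \<and> u \<noteq> v \<and> \<kappa> u = \<kappa> v}"
      by (rule finite_subset[of _ "G \<times> G"]) (use assms in auto)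
  qed
  finally show ?thesis by simp
qed

lemma dyadic_pigeonhole:
  fixes r :: "'x \<Rightarrow> nat"
  assumes "finite X" "\<And>x. x \<in> X \<Longrightarrow> r x \<le> N" "0 < k"
  obtains \<delta> where "0 < \<delta>"
    "(\<Sum>x\<in>X. r x ^ k) \<le> Suc (floor_log N) * ((2 * \<delta>) ^ k * card {x \<in> X. \<delta> \<le> r x})"
proof -
  let ?l = "floor_log N"
  define F where "F i = (2 * 2 ^ i) ^ k * card {x \<in> X. 2 ^ i \<le> r x}" for i :: nat
  have "Max (F ` {..?l}) \<in> F ` {..?l}" by (intro Max_in) auto
  then obtain j where "Max (F ` {..?l}) = F j" by blast
  then have j: "F i \<le> F j" if "i \<le> ?l" for i
    using that Max_ge[of "F ` {..?l}" "F i"] by simp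
  have level: "r x ^ k \<le> (\<Sum>i\<le>?l. if 2 ^ i \<le> r x then (2 * 2 ^ i) ^ k else 0)" if "x \<in> X" for x
  proof (cases "r x = 0")
    case False
    let ?i = "floor_log (r x)"
    have "r x ^ k \<le> (2 * 2 ^ ?i) ^ k" by (intro power_mono floor_log_exp2_ge) simp
    also have "\<dots> = (if 2 ^ ?i \<le> r x then (2 * 2 ^ ?i) ^ k else 0)"
      using False floor_log_exp2_le[of "r x"] by simp
    also have "\<dots> \<le> (\<Sum>i\<le>?l. if 2 ^ i \<le> r x then (2 * 2 ^ i) ^ k else 0)"
      using floor_log_le_iff[OF assms(2)[OF that]]
      by (intro member_le_sum[of ?i "{..?l}" "\<lambda>i. if 2 ^ i \<le> r x then (2 * 2 ^ i) ^ k else 0"]) auto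
    finally show ?thesis .
  qed (use assms(3) in simp)
  have "(\<Sum>x\<in>X. r x ^ k) \<le> (\<Sum>x\<in>X. \<Sum>i\<le>?l. if 2 ^ i \<le> r x then (2 * 2 ^ i) ^ k else 0)"
    using level by (rule sum_mono)
  also have "\<dots> = (\<Sum>i\<le>?l. F i)"
    unfolding F_def using assms(1)
    by (subst sum.swap) (simp add: sum.inter_filter[symmetric] mult.commute)
  also have "\<dots> \<le> Suc ?l * F j"
    using sum_bounded_above[of "{..?l}" F "F j"] j by simp
  finally show ?thesis by (intro that[of "2 ^ j"]) (auto simp: F_def)
qed

subsection \<open>Incidences of a Cartesian product with monotone pseudolines\<close>

definition block :: "'a::linorder set \<Rightarrow> nat \<Rightarrow> 'a \<Rightarrow> nat" where
  "block Q k q = card {q' \<in> Q. q' < q} div k"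

lemma mono_block:
  assumes "finite Q" shows "mono (block Q k)"
  unfolding block_def using assms by (intro monoI div_le_mono card_mono) auto

lemma block_le:
  assumes "finite Q" shows "block Q k q \<le> card Q div k"
  unfolding block_def using assms by (intro div_le_mono card_mono) auto

lemma card_block_le:
  assumes "finite Q" "0 < k" shows "card {q \<in> Q. block Q k q = j} \<le> k"
proof -
  let ?r = "\<lambda>q. card {q' \<in> Q. q' < q}"
  have "inj_on ?r {q \<in> Q. block Q k q = j}"
  proof (rule linorder_inj_onI)
    fix q q' assume "q < q'" "q \<in> {q \<in> Q. block Q k q = j}"
    then have "?r q < ?r q'" using assms(1) by (intro psubset_card_mono) auto
    then show "?r q \<noteq> ?r q'" by simp
  qed auto
  moreover have "?r ` {q \<in> Q. block Q k q = j} \<subseteq> {j * k ..< j * k + k}"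
    unfolding block_def using \<open>0 < k\<close>
    by (auto simp: dividend_less_div_times div_times_less_eq_dividend add.commute[of _ k])
  ultimately have "card {q \<in> Q. block Q k q = j} \<le> card {j * k ..< j * k + k}"
    by (intro card_inj_on_le) auto
  then show ?thesis by simp
qed

definition cell :: "'a::linorder set \<Rightarrow> 'b::linorder set \<Rightarrow> nat \<Rightarrow> nat \<Rightarrow> 'a \<times> 'b \<Rightarrow> nat \<times> nat" where
  "cell Q X k m = map_prod (block Q k) (block X m)"

lemma card_pairs_in_cell_le:
  assumes "finite Q" "finite X" "0 < k" "0 < m"
  shows "card (coincidences (cell Q X k m) (Q \<times> X) (cell Q X k m) (Q \<times> X))
    \<le> card Q * card X * (k * m)"
proof -
  let ?N = "\<lambda>u. {q \<in> Q. block Q k q = block Q k (fst u)}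
    \<times> {x \<in> X. block X m x = block X m (snd u)}"
  have "coincidences (cell Q X k m) (Q \<times> X) (cell Q X k m) (Q \<times> X) = Sigma (Q \<times> X) ?N"
    by (auto simp: coincidences_def cell_def)
  also have "card \<dots> = (\<Sum>u\<in>Q \<times> X. card (?N u))"
    using assms by (intro card_SigmaI) auto
  also have "\<dots> \<le> (\<Sum>u\<in>Q \<times> X. k * m)"
    unfolding card_cartesian_product using assms by (intro sum_mono mult_mono card_block_le) auto
  finally show ?thesis by (simp add: card_cartesian_product)
qed

lemma card_image_Pair_mono_le:
  fixes \<phi> \<psi> :: "'a::linorder \<Rightarrow> nat"
  assumes "mono_on G \<phi>" "mono_on G \<psi>" "\<And>q. q \<in> G \<Longrightarrow> \<phi> q \<le> K" "\<And>q. q \<in> G \<Longrightarrow> \<psi> q \<le> M"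
  shows "card ((\<lambda>q. (\<phi> q, \<psi> q)) ` G) \<le> K + M + 1"
proof -
  have eq_if_same_sum: "\<phi> q = \<phi> q' \<and> \<psi> q = \<psi> q'"
    if "q \<in> G" "q' \<in> G" "q \<le> q'" "\<phi> q + \<psi> q = \<phi> q' + \<psi> q'" for q q'
    using that(4) mono_onD[OF assms(1) that(1-3)] mono_onD[OF assms(2) that(1-3)] by linarith
  have "inj_on (\<lambda>(i, j). i + j) ((\<lambda>q. (\<phi> q, \<psi> q)) ` G)"
  proof (rule inj_onI, clarsimp)
    fix q q' assume "q \<in> G" "q' \<in> G" "\<phi> q + \<psi> q = \<phi> q' + \<psi> q'"
    then show "\<phi> q = \<phi> q' \<and> \<psi> q = \<psi> q'"
      using eq_if_same_sum[of q q'] eq_if_same_sum[of q' q] linear[of q q'] by metis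
  qed
  moreover have "(\<lambda>(i, j). i + j) ` (\<lambda>q. (\<phi> q, \<psi> q)) ` G \<subseteq> {..K + M}"
    using assms(3,4) by (auto intro: add_mono)
  ultimately have "card ((\<lambda>q. (\<phi> q, \<psi> q)) ` G) \<le> card {..K + M}"
    by (rule card_inj_on_le) simp
  then show ?thesis by simp
qed

lemma card_image_Pair_antimono_le:
  fixes \<phi> \<psi> :: "'a::linorder \<Rightarrow> nat"
  assumes "mono_on G \<phi>" "antimono_on G \<psi>" "\<And>q. q \<in> G \<Longrightarrow> \<phi> q \<le> K" "\<And>q. q \<in> G \<Longrightarrow> \<psi> q \<le> M"
  shows "card ((\<lambda>q. (\<phi> q, \<psi> q)) ` G) \<le> K + M + 1"
proof -
  have "(\<lambda>q. (\<phi> q, M - \<psi> q)) ` G = map_prod id (\<lambda>j. M - j) ` (\<lambda>q. (\<phi> q, \<psi> q)) ` G"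
    by (simp add: image_image)
  also have "card \<dots> = card ((\<lambda>q. (\<phi> q, \<psi> q)) ` G)"
    using assms(4) by (intro card_image inj_onI) (auto, metis diff_diff_cancel)
  finally have "card ((\<lambda>q. (\<phi> q, \<psi> q)) ` G) = card ((\<lambda>q. (\<phi> q, M - \<psi> q)) ` G)" by simp
  also have "\<dots> \<le> K + M + 1"
    using assms
    by (intro card_image_Pair_mono_le) (auto simp: monotone_on_def intro!: diff_le_mono2)
  finally show ?thesis .
qed

lemma card_cells_of_monotone_le:
  assumes "finite Q" "finite X" "mono_on G h \<or> antimono_on G h"
  shows "card ((\<lambda>q. cell Q X k m (q, h q)) ` G) \<le> card Q div k + card X div m + 1"
proof -
  have mono_block_Q: "mono_on G (block Q k)"
    using mono_block[OF assms(1)] by (rule mono_on_subset) simp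
  note block_bounds = block_le[OF assms(1)] block_le[OF assms(2)]
  show ?thesis
    unfolding cell_def map_prod_simp using assms(3)
  proof
    assume "mono_on G h"
    then have "mono_on G (\<lambda>q. block X m (h q))"
      using monoD[OF mono_block[OF assms(2)]] by (auto simp: monotone_on_def)
    then show "card ((\<lambda>q. (block Q k q, block X m (h q))) ` G) \<le> card Q div k + card X div m + 1"
      by (rule card_image_Pair_mono_le[OF mono_block_Q _ block_bounds])
  next
    assume "antimono_on G h"
    then have "antimono_on G (\<lambda>q. block X m (h q))"
      using monoD[OF mono_block[OF assms(2)]] by (auto simp: monotone_on_def)
    then show "card ((\<lambda>q. (block Q k q, block X m (h q))) ` G) \<le> card Q div k + card X div m + 1"
      by (rule card_image_Pair_antimono_le[OF mono_block_Q _ block_bounds])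
  qed
qed

lemma obtain_nat_between_mult:
  fixes x :: real and c :: nat
  assumes "1 \<le> x" "0 < c"
  obtains k :: nat where "0 < k" "c * x \<le> k" "k \<le> Suc c * x"
proof (rule that[of "nat \<lceil>c * x\<rceil>"])
  have "0 < c * x" using assms by simp
  then show "0 < nat \<lceil>c * x\<rceil>" by simp
  show "c * x \<le> nat \<lceil>c * x\<rceil>" by (rule real_nat_ceiling_ge)
  have "nat \<lceil>c * x\<rceil> < c * x + 1" using \<open>0 < c * x\<close> by linarith
  then show "nat \<lceil>c * x\<rceil> \<le> Suc c * x" using assms(1) by (simp add: algebra_simps)
qed

text \<open>The choice \<open>k \<approx> 6 N q / (w x)\<close>, \<open>m \<approx> 6 N / w\<close> makes the term with the factor \<open>N\<close>
  at most \<open>w x / 2\<close>.\<close>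

lemma power3_mult_le_of_block_bound:
  fixes w N q x :: real
  assumes "0 < w" "0 \<le> x" "0 \<le> q" "w \<le> N" "w * x \<le> N * q" "6 * N \<le> w * x"
    and block_bound: "\<And>k m :: nat. \<lbrakk>0 < k; 0 < m\<rbrakk> \<Longrightarrow>
      w * x \<le> N * (q / real k + x / real m + 1) + q * x * (real k * real m)"
  shows "w ^ 3 * x \<le> 98 * (N * q)\<^sup>2"
proof -
  have wx: "0 < w * x" using assms(1,4,6) by linarith
  then have x: "0 < x" using assms(1) by (simp add: zero_less_mult_iff)
  have "1 \<le> N * q / (w * x)" using assms(5) wx by simp
  then obtain k :: nat where k: "0 < k" "6 * (N * q / (w * x)) \<le> k" "k \<le> 7 * (N * q / (w * x))"
    by (rule obtain_nat_between_mult[of _ 6]) auto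
  have "1 \<le> N / w" using assms(1,4) by simp
  then obtain m :: nat where m: "0 < m" "6 * (N / w) \<le> m" "m \<le> 7 * (N / w)"
    by (rule obtain_nat_between_mult[of _ 6]) auto
  have "N * (q / k) \<le> w * x / 6"
    using k(1,2) wx by (simp add: field_simps)
  moreover have "N * (x / m) \<le> w * x / 6"
    using mult_right_mono[OF m(2), of "w * x / 6"] m(1) assms(1) x by (simp add: field_simps)
  moreover have "q * x * (real k * real m) \<le> q * x * ((7 * (N * q / (w * x))) * (7 * (N / w)))"
    using k m x assms(3) by (intro mult_left_mono mult_mono) auto
  moreover have "q * x * ((7 * (N * q / (w * x))) * (7 * (N / w))) = 49 * (N * q)\<^sup>2 / w\<^sup>2"
    using assms(1) x by (simp add: field_simps power2_eq_square)
  ultimately have "w * x / 2 \<le> 49 * (N * q)\<^sup>2 / w\<^sup>2"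
    using block_bound[OF k(1) m(1)] assms(6) unfolding distrib_left by linarith
  then show ?thesis
    using assms(1) by (simp add: field_simps power2_eq_square power3_eq_cube)
qed

locale pseudoline_family =
  fixes Q :: "'a::linorder set" and C :: "'c set"
    and D :: "'c \<Rightarrow> 'a set" and f :: "'c \<Rightarrow> 'a \<Rightarrow> 'b::linorder"
  assumes finite_Q: "finite Q" and finite_C: "finite C"
    and domain_subset: "c \<in> C \<Longrightarrow> D c \<subseteq> Q"
    and monotone: "c \<in> C \<Longrightarrow> mono_on (D c) (f c) \<or> antimono_on (D c) (f c)"
    and eq_if_meet_twice: "\<lbrakk>c \<in> C; c' \<in> C; q \<in> D c \<inter> D c'; q' \<in> D c \<inter> D c'; q < q';
      f c q = f c' q; f c q' = f c' q'\<rbrakk> \<Longrightarrow> c = c'"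
begin

definition incident_points :: "'b set \<Rightarrow> 'c \<Rightarrow> 'a set" where
  "incident_points X c = {q \<in> D c. f c q \<in> X}"

definition incidences :: "'b set \<Rightarrow> ('c \<times> 'a) set" where
  "incidences X = Sigma C (incident_points X)"

lemma incidences_subset: "incidences X \<subseteq> C \<times> Q"
  unfolding incidences_def incident_points_def using domain_subset by auto

lemma finite_incidences: "finite (incidences X)"
  using incidences_subset finite_C finite_Q by (meson finite_SigmaI finite_subset)

lemma finite_incident_points:
  assumes "c \<in> C" shows "finite (incident_points X c)"
  using finite_subset[OF domain_subset[OF assms] finite_Q] by (simp add: incident_points_def)

lemma card_pairs_on_pseudolines_in_cell_le:
  assumes "finite X" "0 < k" "0 < m"
  shows "(\<Sum>c\<in>C. card {(q, q'). q \<in> incident_points X c \<and> q' \<in> incident_points X c \<and> q \<noteq> q' \<and>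
      cell Q X k m (q, f c q) = cell Q X k m (q', f c q')}) \<le> card Q * card X * (k * m)"
    (is "(\<Sum>c\<in>C. card (?W c)) \<le> _")
proof -
  let ?E = "coincidences (cell Q X k m) (Q \<times> X) (cell Q X k m) (Q \<times> X)"
  have finW: "finite (?W c)" if "c \<in> C" for c
    by (rule finite_subset[of _ "incident_points X c \<times> incident_points X c"])
      (use finite_incident_points[OF that] in auto)
  have "(\<Sum>c\<in>C. card (?W c)) = card (Sigma C ?W)"
    using finite_C finW by (intro card_SigmaI[symmetric]) auto
  also have "\<dots> \<le> card ?E"
  proof (rule card_inj_on_le)
    show "inj_on (\<lambda>(c, q, q'). ((q, f c q), (q', f c q'))) (Sigma C ?W)"
    proof (rule inj_onI, clarsimp simp: incident_points_def)
      fix c c' q q'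
      assume "c \<in> C" "c' \<in> C" "q \<in> D c" "q' \<in> D c" "q \<in> D c'" "q' \<in> D c'" "q \<noteq> q'"
        "f c q = f c' q" "f c q' = f c' q'"
      then show "c = c'"
        using eq_if_meet_twice[of c c' q q'] eq_if_meet_twice[of c c' q' q] by (metis IntI neqE)
    qed
    show "(\<lambda>(c, q, q'). ((q, f c q), (q', f c q'))) ` Sigma C ?W \<subseteq> ?E"
      using domain_subset by (auto simp: coincidences_def incident_points_def)
    show "finite ?E" using finite_Q assms(1) by (intro finite_coincidences) auto
  qed
  also have "\<dots> \<le> card Q * card X * (k * m)"
    using finite_Q assms by (intro card_pairs_in_cell_le)
  finally show ?thesis .
qed

theorem card_incidences_le:
  assumes "finite X" "0 < k" "0 < m"
  shows "card (incidences X)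
    \<le> card C * (card Q div k + card X div m + 1) + card Q * card X * (k * m)"
proof -
  let ?K = "card Q div k + card X div m + 1"
  let ?G = "incident_points X"
  define \<kappa> where "\<kappa> c q = cell Q X k m (q, f c q)" for c q
  define W where "W c = {(q, q'). q \<in> ?G c \<and> q' \<in> ?G c \<and> q \<noteq> q' \<and> \<kappa> c q = \<kappa> c q'}" for c
  have "card (incidences X) = (\<Sum>c\<in>C. card (?G c))"
    unfolding incidences_def using finite_C finite_incident_points by (intro card_SigmaI) auto
  also have "\<dots> \<le> (\<Sum>c\<in>C. ?K + card (W c))"
  proof (rule sum_mono)
    fix c assume "c \<in> C"
    have "mono_on (?G c) (f c) \<or> antimono_on (?G c) (f c)"
      using monotone[OF \<open>c \<in> C\<close>] by (auto simp: incident_points_def monotone_on_def)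
    then have "card (\<kappa> c ` ?G c) \<le> ?K"
      unfolding \<kappa>_def using finite_Q assms(1) by (intro card_cells_of_monotone_le)
    then show "card (?G c) \<le> ?K + card (W c)"
      using card_le_card_image_plus_collisions[OF finite_incident_points[OF \<open>c \<in> C\<close>], of X "\<kappa> c"]
      unfolding W_def by linarith
  qed
  also have "\<dots> = card C * ?K + (\<Sum>c\<in>C. card (W c))" by (subst sum.distrib) simp
  also have "\<dots> \<le> card C * ?K + card Q * card X * (k * m)"
    unfolding W_def \<kappa>_def
    by (intro add_left_mono card_pairs_on_pseudolines_in_cell_le assms)
  finally show ?thesis .
qed

lemma real_card_incidences_le:
  assumes "finite X" "0 < k" "0 < m"
  shows "real (card (incidences X))
    \<le> real (card C) * (real (card Q) / real k + real (card X) / real m + 1)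
      + real (card Q) * real (card X) * (real k * real m)"
proof -
  have "real (card (incidences X))
    \<le> real (card C) * (real (card Q div k) + real (card X div m) + 1)
      + real (card Q) * real (card X) * (real k * real m)"
    using of_nat_mono[OF card_incidences_le[OF assms], where 'a = real]
    by (simp only: of_nat_add of_nat_mult of_nat_1)
  also have "\<dots> \<le> real (card C) * (real (card Q) / real k + real (card X) / real m + 1)
      + real (card Q) * real (card X) * (real k * real m)"
    by (intro add_mono mult_left_mono of_nat_div_le_of_nat) auto
  finally show ?thesis .
qed

lemma card_rich_mult_le_card_incidences:
  assumes "finite X" and rich: "\<And>x. x \<in> X \<Longrightarrow> w \<le> real (card (incidences {x}))"
  shows "w * real (card X) \<le> real (card (incidences X))"
proof -
  have "incidences X = (\<Union>x\<in>X. incidences {x})"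
    by (auto simp: incidences_def incident_points_def)
  moreover have "incidences {x} \<inter> incidences {y} = {}" if "x \<noteq> y" for x y
    using that by (auto simp: incidences_def incident_points_def)
  ultimately have "card (incidences X) = (\<Sum>x\<in>X. card (incidences {x}))"
    using assms(1) finite_incidences by (simp add: card_UN_disjoint)
  then have "real (card (incidences X)) = (\<Sum>x\<in>X. real (card (incidences {x})))" by simp
  also have "\<dots> \<ge> (\<Sum>x\<in>X. w)" using rich by (rule sum_mono)
  finally show ?thesis by (simp add: mult.commute)
qed

theorem card_rich_values_le:
  fixes w :: real
  assumes "finite X" "0 < w" and rich: "\<And>x. x \<in> X \<Longrightarrow> w \<le> card (incidences {x})"
    and "w \<le> card C" "w\<^sup>2 \<le> real (card C) * (real (card Q))\<^sup>2"
  shows "w ^ 3 * card X \<le> 98 * (real (card C) * real (card Q))\<^sup>2"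
proof (cases "w * card X < 6 * card C")
  case True
  have "w ^ 3 * card X = w\<^sup>2 * (w * card X)" by (simp add: power2_eq_square power3_eq_cube)
  also have "\<dots> \<le> (real (card C) * (real (card Q))\<^sup>2) * (6 * real (card C))"
    using mult_mono[OF assms(5) less_imp_le[OF True]] assms(2) by simp
  also have "\<dots> = 6 * (real (card C) * real (card Q))\<^sup>2"
    by (simp add: power_mult_distrib power2_eq_square)
  also have "\<dots> \<le> 98 * (real (card C) * real (card Q))\<^sup>2" by simp
  finally show ?thesis .
next
  case False
  have many: "w * card X \<le> card (incidences X)"
    using assms(1) rich by (rule card_rich_mult_le_card_incidences)
  show ?thesis
  proof (rule power3_mult_le_of_block_bound)
    have "card (incidences X) \<le> card (C \<times> Q)"
      using incidences_subset finite_C finite_Q by (intro card_mono) auto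
    then have "real (card (incidences X)) \<le> real (card C) * real (card Q)"
      by (simp add: card_cartesian_product flip: of_nat_mult)
    with many show "w * real (card X) \<le> real (card C) * real (card Q)" by linarith
    show "w * real (card X) \<le> real (card C) * (real (card Q) / real k + real (card X) / real m + 1)
        + real (card Q) * real (card X) * (real k * real m)" if "0 < k" "0 < m" for k m :: nat
      using many real_card_incidences_le[OF assms(1) that] by linarith
  qed (use assms(2,4) False in auto)
qed

end

subsection \<open>Differences and higher energies\<close>

definition diff_set :: "'a::ab_group_add set \<Rightarrow> 'a set \<Rightarrow> 'a set" where
  "diff_set A B = (\<lambda>u. fst u - snd u) ` (A \<times> B)"

definition diff_reps :: "'a::ab_group_add set \<Rightarrow> 'a set \<Rightarrow> 'a \<Rightarrow> nat" where
  "diff_reps A B x = card {u \<in> A \<times> B. fst u - snd u = x}"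

definition energy :: "nat \<Rightarrow> 'a::ab_group_add set \<Rightarrow> 'a set \<Rightarrow> nat" where
  "energy k A B = (\<Sum>x\<in>diff_set A B. diff_reps A B x ^ k)"

lemma finite_diff_set: "\<lbrakk>finite A; finite B\<rbrakk> \<Longrightarrow> finite (diff_set A B)"
  by (simp add: diff_set_def)

lemma diff_set_iff: "x \<in> diff_set A B \<longleftrightarrow> (\<exists>a\<in>A. \<exists>b\<in>B. x = a - b)"
  unfolding diff_set_def by force

lemma diff_set_mono: "\<lbrakk>A \<subseteq> A'; B \<subseteq> B'\<rbrakk> \<Longrightarrow> diff_set A B \<subseteq> diff_set A' B'"
  unfolding diff_set_def by (intro image_mono Sigma_mono)

lemma diff_reps_mono:
  assumes "finite A'" "finite B'" "A \<subseteq> A'" "B \<subseteq> B'"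
  shows "diff_reps A B x \<le> diff_reps A' B' x"
  unfolding diff_reps_def using assms by (intro card_mono) auto

lemma diff_reps_eq_0: "x \<notin> diff_set A B \<Longrightarrow> diff_reps A B x = 0"
  unfolding diff_reps_def by (auto simp: diff_set_iff card_eq_0_iff)

lemma diff_reps_le_card_left: "finite A \<Longrightarrow> diff_reps A B x \<le> card A"
  unfolding diff_reps_def
  by (rule card_inj_on_le[of fst]) (auto intro!: inj_onI simp: prod_eq_iff algebra_simps)

lemma diff_reps_commute: "diff_reps B A (- x) = diff_reps A B x"
proof -
  have "bij_betw prod.swap {u \<in> A \<times> B. fst u - snd u = x} {u \<in> B \<times> A. fst u - snd u = - x}"
    by (rule bij_betwI[of _ _ _ prod.swap]) (auto simp: equation_minus_iff[of _ x])
  then show ?thesis unfolding diff_reps_def by (rule bij_betw_same_card[symmetric])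
qed

lemma diff_reps_le_card_right: "finite B \<Longrightarrow> diff_reps A B x \<le> card B"
  using diff_reps_le_card_left[of B A "- x"] by (simp add: diff_reps_commute)

lemma energy_1:
  assumes "finite A" "finite B"
  shows "energy 1 A B = card A * card B"
  using card_eq_sum_card_fibres[of "A \<times> B" "diff_set A B" "\<lambda>u. fst u - snd u"] assms
  by (simp add: energy_def diff_reps_def diff_set_def card_cartesian_product)

lemma energy_mono:
  assumes "finite A'" "finite B'" "A \<subseteq> A'" "B \<subseteq> B'"
  shows "energy k A B \<le> energy k A' B'"
proof -
  have "energy k A B \<le> (\<Sum>x\<in>diff_set A B. diff_reps A' B' x ^ k)"
    unfolding energy_def using assms by (intro sum_mono power_mono diff_reps_mono) auto
  also have "\<dots> \<le> energy k A' B'"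
    unfolding energy_def using assms by (intro sum_mono2 finite_diff_set diff_set_mono) auto
  finally show ?thesis .
qed

lemma energy_commute: "energy k A B = energy k B A"
proof -
  have "- x \<in> diff_set A B" if "x \<in> diff_set B A" for x and A B :: "'a set"
    using that by (force simp: diff_set_iff)
  then show ?thesis
    unfolding energy_def
    by (intro sum.reindex_bij_witness[of _ uminus uminus]) (auto simp: diff_reps_commute)
qed

lemma sum_diff_reps_power_le_energy:
  assumes "finite A" "finite B" "0 < k"
  shows "(\<Sum>x\<in>Y. diff_reps A B x ^ k) \<le> energy k A B"
proof (cases "finite Y")
  case True
  then have "(\<Sum>x\<in>Y. diff_reps A B x ^ k) = (\<Sum>x\<in>Y \<inter> diff_set A B. diff_reps A B x ^ k)"
    using assms(3) by (intro sum.mono_neutral_right) (auto simp: diff_reps_eq_0)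
  also have "\<dots> \<le> energy k A B"
    unfolding energy_def using assms by (intro sum_mono2 finite_diff_set) auto
  finally show ?thesis .
qed simp

definition equal_differences ::
    "'a::ab_group_add set \<Rightarrow> 'a set \<Rightarrow> 'a set \<Rightarrow> 'a set \<Rightarrow> (('a \<times> 'a) \<times> ('a \<times> 'a)) set" where
  "equal_differences A B C D
    = coincidences (\<lambda>u. fst u - snd u) (A \<times> B) (\<lambda>v. fst v - snd v) (C \<times> D)"

lemma finite_equal_differences:
  "\<lbrakk>finite A; finite B; finite C; finite D\<rbrakk> \<Longrightarrow> finite (equal_differences A B C D)"
  unfolding equal_differences_def by (intro finite_coincidences) auto

lemma card_equal_differences:
  assumes "finite A" "finite B" "finite C" "finite D"
  shows "card (equal_differences A B C D)
    = (\<Sum>x\<in>diff_set A B. diff_reps A B x * diff_reps C D x)"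
  unfolding equal_differences_def diff_reps_def using assms
  by (intro card_coincidences finite_diff_set) (auto simp: diff_set_def)

lemma card_equal_differences_power6_le:
  assumes "finite A" "finite B" "finite C" "finite D"
  shows "card (equal_differences A B C D) ^ 6
    \<le> (card A * card B) ^ 3 * (energy 3 A B * (energy 3 C D)\<^sup>2)"
proof -
  let ?X = "diff_set A B"
  let ?r = "\<lambda>x. real (diff_reps A B x)" and ?s = "\<lambda>x. real (diff_reps C D x)"
  have "(\<Sum>x\<in>?X. ?r x * ?s x) ^ 6
    \<le> (\<Sum>x\<in>?X. ?r x) ^ 3 * ((\<Sum>x\<in>?X. ?r x ^ 3) * (\<Sum>x\<in>?X. ?s x ^ 3)\<^sup>2)"
    by (intro sum_mult_power6_le) auto
  then have "real ((\<Sum>x\<in>?X. diff_reps A B x * diff_reps C D x) ^ 6)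
    \<le> real ((energy 1 A B) ^ 3 * (energy 3 A B * (\<Sum>x\<in>?X. diff_reps C D x ^ 3)\<^sup>2))"
    by (simp add: energy_def)
  then have "(\<Sum>x\<in>?X. diff_reps A B x * diff_reps C D x) ^ 6
    \<le> (energy 1 A B) ^ 3 * (energy 3 A B * (\<Sum>x\<in>?X. diff_reps C D x ^ 3)\<^sup>2)"
    by (simp only: of_nat_le_iff)
  also have "\<dots> \<le> (energy 1 A B) ^ 3 * (energy 3 A B * (energy 3 C D)\<^sup>2)"
    using assms by (intro mult_left_mono power_mono sum_diff_reps_power_le_energy) auto
  finally show ?thesis using assms by (simp only: card_equal_differences energy_1)
qed

text \<open>The equation \<open>a + b = a' + b'\<close> is rewritten as \<open>a - b' = a' - b\<close>.\<close>

lemma card_power2_mult_le_card_sumset_energy: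
  assumes "finite A" "finite B"
  shows "(card A * card B)\<^sup>2 \<le> card (A + B) * energy 2 A B"
proof -
  let ?C = "coincidences (\<lambda>u. fst u + snd u) (A \<times> B) (\<lambda>v. fst v + snd v) (A \<times> B)"
  have "(card (A \<times> B))\<^sup>2 \<le> card (A + B) * card ?C"
    using assms by (intro card_power2_le_card_mult_coincidences finite_set_plus) auto
  also have "card ?C \<le> card (equal_differences A B A B)"
  proof (rule card_inj_on_le)
    show "inj_on (\<lambda>((a, b), (a', b')). ((a, b'), (a', b))) ?C" by (auto intro!: inj_onI)
    show "(\<lambda>((a, b), (a', b')). ((a, b'), (a', b))) ` ?C \<subseteq> equal_differences A B A B"
      by (auto simp: coincidences_def equal_differences_def algebra_simps)
    show "finite (equal_differences A B A B)" using assms by (intro finite_equal_differences)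
  qed
  also have "\<dots> = energy 2 A B"
    using assms by (simp add: card_equal_differences energy_def power2_eq_square)
  finally show ?thesis by (simp add: card_cartesian_product)
qed

text \<open>Two triples with the same image satisfy \<open>a - a' = b - b' = c' - c\<close>.\<close>

lemma card_power2_le_card_translated_pairs_mult_energy:
  assumes "finite A" "H \<subseteq> (A \<times> A) \<times> A"
  shows "(card H)\<^sup>2 \<le> card ((\<lambda>((a, b), c). (a + c, b + c)) ` H) * energy 3 A A"
proof -
  let ?f = "\<lambda>((a, b), c). (a + c, b + c)"
  let ?C = "coincidences ?f H ?f H"
  let ?B = "\<lambda>x. {u \<in> A \<times> A. fst u - snd u = x}"
  let ?E = "SIGMA x:diff_set A A. ?B x \<times> ?B x \<times> ?B x"
  have finH: "finite H" using assms by (meson finite_SigmaI finite_subset)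
  then have "(card H)\<^sup>2 \<le> card (?f ` H) * card ?C"
    by (intro card_power2_le_card_mult_coincidences) auto
  also have "card ?C \<le> card ?E"
  proof (rule card_inj_on_le)
    let ?h = "\<lambda>(((a, b), c), ((a', b'), c')). (a - a', (a, a'), (b, b'), (c', c))"
    show "inj_on ?h ?C" by (auto intro!: inj_onI)
    show "?h ` ?C \<subseteq> ?E"
    proof (rule image_subsetI)
      fix t assume "t \<in> ?C"
      then obtain a b c a' b' c' where t: "t = (((a, b), c), ((a', b'), c'))"
        and H: "((a, b), c) \<in> H" "((a', b'), c') \<in> H"
        and eq: "a + c = a' + c'" "b + c = b' + c'" by (auto simp: coincidences_def)
      have "c' - c = a - a'" "c' - c = b - b'" using eq by (simp_all add: algebra_simps)
      moreover have "a \<in> A" "b \<in> A" "c \<in> A" "a' \<in> A" "b' \<in> A" "c' \<in> A" using H assms(2) by auto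
      ultimately show "?h t \<in> ?E" unfolding t by (auto simp: diff_set_iff)
    qed
    show "finite ?E" using assms(1) by (intro finite_SigmaI finite_diff_set) auto
  qed
  also have "card ?E = energy 3 A A"
    using assms(1) finite_diff_set[OF assms(1,1)]
    by (simp add: card_cartesian_product energy_def diff_reps_def power3_eq_cube mult.assoc)
  finally show ?thesis by simp
qed

subsection \<open>Growth of sumsets from third moments\<close>

text \<open>The exponents come from eliminating \<open>\<tau>\<close> by means of the last two hypotheses and multiplying
  the result by the ninth power of the first hypothesis and the square of the second.\<close>

lemma power41_le_of_energy_bounds:
  fixes n s l M d \<delta> \<tau> :: real
  assumes pos: "0 < n" "0 < s" "0 < l" "0 \<le> M" "0 < d" "0 \<le> \<delta>" "0 \<le> \<tau>"
    and energy: "n ^ 4 \<le> 64 * s * l * (d * \<delta>\<^sup>2)"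
    and third_moment: "d * \<delta> ^ 3 \<le> M * n\<^sup>2"
    and pairs: "(d * \<delta>)\<^sup>2 \<le> 4 * M * \<tau>"
    and Hoelder: "(n\<^sup>2 * \<tau>) ^ 6 \<le> (8 * s) ^ 6 * (n ^ 3 * d ^ 5 * M ^ 3 * s ^ 4)"
  shows "n ^ 41 \<le> 2 ^ 84 * l ^ 9 * M ^ 11 * s ^ 19"
proof -
  have "(n\<^sup>2 * (d * \<delta>)\<^sup>2) ^ 6 \<le> (4 * M * (n\<^sup>2 * \<tau>)) ^ 6"
    using mult_left_mono[OF pairs, of "n\<^sup>2"] pos by (intro power_mono) (auto simp: mult_ac)
  also have "\<dots> \<le> (4 * M) ^ 6 * ((8 * s) ^ 6 * (n ^ 3 * d ^ 5 * M ^ 3 * s ^ 4))"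
    unfolding power_mult_distrib[of "4 * M"] using Hoelder pos by (intro mult_left_mono) auto
  also have "\<dots> = (n ^ 3 * d ^ 5) * (2 ^ 30 * M ^ 9 * s ^ 10)" by algebra
  also have "(n\<^sup>2 * (d * \<delta>)\<^sup>2) ^ 6 = (n ^ 3 * d ^ 5) * (d ^ 7 * \<delta> ^ 12 * n ^ 9)" by algebra
  finally have without_\<tau>: "d ^ 7 * \<delta> ^ 12 * n ^ 9 \<le> 2 ^ 30 * M ^ 9 * s ^ 10"
    by (rule mult_left_le_imp_le) (use pos in simp)
  have "n ^ 36 * n ^ 9 = (n ^ 4) ^ 9 * n ^ 9" by simp
  also have "\<dots> \<le> (64 * s * l * (d * \<delta>\<^sup>2)) ^ 9 * n ^ 9"
    using energy pos by (intro mult_right_mono power_mono) auto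
  also have "\<dots> = 2 ^ 54 * s ^ 9 * l ^ 9 * ((d ^ 7 * \<delta> ^ 12 * n ^ 9) * (d * \<delta> ^ 3)\<^sup>2)"
    by (simp add: power_mult_distrib mult_ac flip: power_mult power_add)
  also have "\<dots> \<le> 2 ^ 54 * s ^ 9 * l ^ 9 * ((2 ^ 30 * M ^ 9 * s ^ 10) * (M * n\<^sup>2)\<^sup>2)"
    using pos by (intro mult_left_mono mult_mono without_\<tau> power_mono third_moment) auto
  also have "\<dots> = n ^ 4 * (2 ^ 84 * l ^ 9 * M ^ 11 * s ^ 19)"
    by (simp add: power_mult_distrib mult_ac flip: power_mult power_add)
  finally have "n ^ 4 * n ^ 41 \<le> n ^ 4 * (2 ^ 84 * l ^ 9 * M ^ 11 * s ^ 19)"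
    by (simp flip: power_add)
  then show ?thesis by (rule mult_left_le_imp_le) (use pos in simp)
qed

locale third_moment_bound =
  fixes A :: "'a::ab_group_add set" and M :: real
  assumes finite_A: "finite A" and A_nonempty: "A \<noteq> {}"
    and energy3_le: "finite B \<Longrightarrow> energy 3 A B \<le> M * (real (card B))\<^sup>2"
begin

definition sum_reps :: "'a \<Rightarrow> nat" where
  "sum_reps z = card {u \<in> A \<times> A. fst u + snd u = z}"

definition popular :: "'a set" where
  "popular = {z \<in> A + A. (card A)\<^sup>2 \<le> 8 * card (A + A) * sum_reps z}"

definition core :: "'a set" where
  "core = {a \<in> A. 4 * card {c \<in> A. a + c \<notin> popular} \<le> card A}"

definition popular_diffs :: "nat \<Rightarrow> 'a set" where
  "popular_diffs \<delta> = {x \<in> diff_set core core. \<delta> \<le> diff_reps core core x}"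

definition popular_pairs :: "nat \<Rightarrow> ('a \<times> 'a) set" where
  "popular_pairs \<delta> = {v \<in> popular \<times> popular. fst v - snd v \<in> popular_diffs \<delta>}"

lemma M_nonneg: "0 \<le> M"
  using energy3_le[of "{0}"] by simp

lemma card_A_pos: "0 < card A"
  using finite_A A_nonempty by (simp add: card_gt_0_iff)

lemma finite_sumset: "finite (A + A)"
  using finite_A by (simp add: finite_set_plus)

lemma card_sumset_pos: "0 < card (A + A)"
  using finite_sumset A_nonempty by (auto simp: card_gt_0_iff)

lemma popular_subset: "popular \<subseteq> A + A"
  by (auto simp: popular_def)

lemma finite_popular: "finite popular"
  using popular_subset finite_sumset by (rule finite_subset)

lemma core_subset: "core \<subseteq> A"
  by (auto simp: core_def)

lemma finite_core: "finite core"
  using core_subset finite_A by (rule finite_subset)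

lemma finite_popular_diffs: "finite (popular_diffs \<delta>)"
  using finite_core by (simp add: popular_diffs_def finite_diff_set)

lemma finite_popular_pairs: "finite (popular_pairs \<delta>)"
  using finite_popular by (simp add: popular_pairs_def)

lemma card_unpopular_sums_le: "8 * card {u \<in> A \<times> A. fst u + snd u \<notin> popular} \<le> (card A)\<^sup>2"
proof -
  let ?s = "card (A + A)"
  let ?U = "{u \<in> A \<times> A. fst u + snd u \<notin> popular}"
  let ?N = "(A + A) - popular"
  have "card ?U = (\<Sum>z\<in>?N. card {u \<in> ?U. fst u + snd u = z})"
    using finite_A finite_sumset by (intro card_eq_sum_card_fibres) auto
  also have "\<dots> \<le> (\<Sum>z\<in>?N. sum_reps z)"
    unfolding sum_reps_def using finite_A by (intro sum_mono card_mono) auto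
  finally have "8 * ?s * card ?U \<le> (\<Sum>z\<in>?N. 8 * ?s * sum_reps z)"
    by (simp add: sum_distrib_left[symmetric])
  also have "\<dots> \<le> (\<Sum>z\<in>?N. (card A)\<^sup>2)"
    by (intro sum_mono) (auto simp: popular_def)
  also have "\<dots> = card ?N * (card A)\<^sup>2" by simp
  also have "\<dots> \<le> ?s * (card A)\<^sup>2"
    using finite_sumset by (intro mult_right_mono card_mono) auto
  finally show ?thesis using card_sumset_pos by simp
qed

lemma card_A_le_card_core: "card A \<le> 2 * card core"
proof -
  let ?n = "card A" and ?N = "\<lambda>a. {c \<in> A. a + c \<notin> popular}"
  let ?U = "{u \<in> A \<times> A. fst u + snd u \<notin> popular}"
  have "card (A - core) * ?n = (\<Sum>a\<in>A - core. ?n)" by simp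
  also have "\<dots> \<le> (\<Sum>a\<in>A - core. 4 * card (?N a))"
    by (intro sum_mono) (auto simp: core_def)
  also have "\<dots> = 4 * card (SIGMA a:A - core. ?N a)"
    using finite_A by (simp add: sum_distrib_left)
  also have "\<dots> \<le> 4 * card ?U"
    using finite_A by (intro mult_left_mono card_mono) auto
  finally have "2 * card (A - core) * ?n \<le> ?n * ?n"
    using card_unpopular_sums_le unfolding power2_eq_square by linarith
  then have "2 * card (A - core) \<le> ?n" using card_A_pos by simp
  then show ?thesis
    using core_subset finite_core by (simp add: card_Diff_subset)
qed

lemma card_power4_le_energy_core: "card A ^ 4 \<le> 16 * (card (A + A) * energy 2 core core)"
proof -
  have "card A ^ 4 \<le> (2 * card core) ^ 4" using card_A_le_card_core by (rule power_mono) simp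
  also have "\<dots> = 16 * (card core * card core)\<^sup>2" by (simp add: power_mult_distrib flip: power_add)
  also have "(card core * card core)\<^sup>2 \<le> card (core + core) * energy 2 core core"
    using finite_core finite_core by (rule card_power2_mult_le_card_sumset_energy)
  also have "card (core + core) \<le> card (A + A)"
    using finite_sumset core_subset by (intro card_mono set_plus_mono2)
  finally show ?thesis by simp
qed

lemma obtain_dominant_popularity:
  obtains \<delta> where "0 < \<delta>"
    "card A ^ 4 \<le> 64 * card (A + A) * Suc (floor_log (card A)) * (card (popular_diffs \<delta>) * \<delta>\<^sup>2)"
proof -
  have reps_le: "diff_reps core core x \<le> card A" for x
    using diff_reps_le_card_left[OF finite_core] card_mono[OF finite_A core_subset]
    by (rule le_trans)
  show ?thesis
  proof (rule dyadic_pigeonhole[OF finite_diff_set[OF finite_core finite_core] reps_le pos2])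
    fix \<delta> :: nat
    assume "0 < \<delta>" "(\<Sum>x\<in>diff_set core core. (diff_reps core core x)\<^sup>2)
      \<le> Suc (floor_log (card A))
        * ((2 * \<delta>)\<^sup>2 * card {x \<in> diff_set core core. \<delta> \<le> diff_reps core core x})"
    then have "energy 2 core core \<le> Suc (floor_log (card A)) * (4 * (card (popular_diffs \<delta>) * \<delta>\<^sup>2))"
      by (simp only: energy_def popular_diffs_def power_mult_distrib) (simp add: mult_ac)
    then have "card A ^ 4
      \<le> 16 * (card (A + A) * (Suc (floor_log (card A)) * (4 * (card (popular_diffs \<delta>) * \<delta>\<^sup>2))))"
      by (intro order.trans[OF card_power4_le_energy_core] mult_left_mono) auto
    then show thesis using \<open>0 < \<delta>\<close> by (intro that) (simp_all add: algebra_simps)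
  qed
qed

lemma card_popular_diffs_mult_power3_le:
  "real (card (popular_diffs \<delta>)) * real \<delta> ^ 3 \<le> M * (real (card A))\<^sup>2"
proof -
  have "card (popular_diffs \<delta>) * \<delta> ^ 3 = (\<Sum>x\<in>popular_diffs \<delta>. \<delta> ^ 3)" by simp
  also have "\<dots> \<le> (\<Sum>x\<in>popular_diffs \<delta>. diff_reps core core x ^ 3)"
    by (intro sum_mono power_mono) (auto simp: popular_diffs_def)
  also have "\<dots> \<le> energy 3 core core"
    using finite_core by (intro sum_diff_reps_power_le_energy) auto
  also have "\<dots> \<le> energy 3 A A"
    using finite_A core_subset by (intro energy_mono)
  finally have "real (card (popular_diffs \<delta>) * \<delta> ^ 3) \<le> real (energy 3 A A)" by (rule of_nat_mono)
  also have "\<dots> \<le> M * (real (card A))\<^sup>2" using finite_A by (rule energy3_le)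
  finally show ?thesis by simp
qed

lemma card_popular_translates_ge:
  assumes "a \<in> core" "b \<in> core"
  shows "card A \<le> 2 * card {c \<in> A. a + c \<in> popular \<and> b + c \<in> popular}"
proof -
  let ?N = "\<lambda>a. {c \<in> A. a + c \<notin> popular}" and ?H = "{c \<in> A. a + c \<in> popular \<and> b + c \<in> popular}"
  have "card A \<le> card (?H \<union> (?N a \<union> ?N b))"
    using finite_A by (intro card_mono) auto
  also have "\<dots> \<le> card ?H + (card (?N a) + card (?N b))"
    by (meson add_left_mono card_Un_le le_trans)
  finally show ?thesis using assms by (simp add: core_def)
qed

lemma card_popular_pairs_ge:
  "(real (card (popular_diffs \<delta>)) * real \<delta>)\<^sup>2 \<le> 4 * M * card (popular_pairs \<delta>)"
proof -
  let ?d = "card (popular_diffs \<delta>)" and ?n = "card A" and ?\<tau> = "card (popular_pairs \<delta>)"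
  define E where "E = {u \<in> core \<times> core. fst u - snd u \<in> popular_diffs \<delta>}"
  define H where "H = (SIGMA u:E. {c \<in> A. fst u + c \<in> popular \<and> snd u + c \<in> popular})"
  have finE: "finite E" using finite_core by (simp add: E_def)
  have "?d * \<delta> = (\<Sum>x\<in>popular_diffs \<delta>. \<delta>)" by simp
  also have "\<dots> \<le> (\<Sum>x\<in>popular_diffs \<delta>. diff_reps core core x)"
    by (intro sum_mono) (auto simp: popular_diffs_def)
  also have "\<dots> = (\<Sum>x\<in>popular_diffs \<delta>. card {u \<in> E. fst u - snd u = x})"
    unfolding diff_reps_def E_def by (intro sum.cong arg_cong[of _ _ card]) auto
  also have "\<dots> = card E"
    using finE finite_popular_diffs
    by (intro card_eq_sum_card_fibres[symmetric]) (auto simp: E_def)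
  finally have "?d * \<delta> * ?n \<le> (\<Sum>u\<in>E. ?n)" by simp
  also have "\<dots> \<le> (\<Sum>u\<in>E. 2 * card {c \<in> A. fst u + c \<in> popular \<and> snd u + c \<in> popular})"
    by (intro sum_mono card_popular_translates_ge) (auto simp: E_def)
  also have "\<dots> = 2 * card H"
    unfolding H_def using finE finite_A by (simp add: sum_distrib_left)
  finally have "(?d * \<delta> * ?n)\<^sup>2 \<le> (2 * card H)\<^sup>2" by (rule power_mono) simp
  also have "\<dots> = 4 * (card H)\<^sup>2" by (simp add: power_mult_distrib)
  also have "(card H)\<^sup>2 \<le> card ((\<lambda>((a, b), c). (a + c, b + c)) ` H) * energy 3 A A"
    using core_subset
    by (intro card_power2_le_card_translated_pairs_mult_energy finite_A) (auto simp: H_def E_def)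
  also have "card ((\<lambda>((a, b), c). (a + c, b + c)) ` H) \<le> ?\<tau>"
    by (intro card_mono finite_popular_pairs) (auto simp: H_def E_def popular_pairs_def)
  finally have "(?d * \<delta> * ?n)\<^sup>2 \<le> 4 * (?\<tau> * energy 3 A A)" by simp
  then have "real ((?d * \<delta> * ?n)\<^sup>2) \<le> real (4 * (?\<tau> * energy 3 A A))" by (rule of_nat_mono)
  also have "\<dots> \<le> 4 * (?\<tau> * (M * (real ?n)\<^sup>2))"
    using energy3_le[OF finite_A] by (simp add: mult_left_mono)
  finally have "(real ?d * \<delta>)\<^sup>2 * (real ?n)\<^sup>2 \<le> 4 * M * ?\<tau> * (real ?n)\<^sup>2"
    by (simp add: power_mult_distrib mult_ac)
  then show ?thesis by (rule mult_right_le_imp_le) (use card_A_pos in simp)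
qed

text \<open>A representation \<open>z = a + c\<close> of the first component of a popular pair \<open>(z, z')\<close> solves
  \<open>a - x = z' - c\<close> with \<open>x = z - z'\<close> a popular difference.\<close>

lemma card_popular_pairs_le_card_equal_differences:
  "(card A)\<^sup>2 * card (popular_pairs \<delta>)
    \<le> 8 * card (A + A) * card (equal_differences A (popular_diffs \<delta>) popular A)"
proof -
  let ?W = "\<lambda>v. {u \<in> A \<times> A. fst u + snd u = fst v}"
  let ?R = "SIGMA v:popular_pairs \<delta>. ?W v"
  have "(card A)\<^sup>2 * card (popular_pairs \<delta>) = (\<Sum>v\<in>popular_pairs \<delta>. (card A)\<^sup>2)" by simp
  also have "\<dots> \<le> (\<Sum>v\<in>popular_pairs \<delta>. 8 * card (A + A) * card (?W v))"
    by (intro sum_mono) (auto simp: popular_pairs_def popular_def sum_reps_def)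
  also have "\<dots> = 8 * card (A + A) * card ?R"
    using finite_popular_pairs finite_A by (simp add: sum_distrib_left)
  also have "card ?R \<le> card (equal_differences A (popular_diffs \<delta>) popular A)"
  proof (rule card_inj_on_le)
    let ?h = "\<lambda>((z, z'), (a, c)). ((a, z - z'), (z', c))"
    show "inj_on ?h ?R" by (auto intro!: inj_onI)
    show "?h ` ?R \<subseteq> equal_differences A (popular_diffs \<delta>) popular A"
      by (auto simp: equal_differences_def coincidences_def popular_pairs_def algebra_simps)
    show "finite (equal_differences A (popular_diffs \<delta>) popular A)"
      by (intro finite_equal_differences finite_A finite_popular_diffs finite_popular)
  qed
  finally show ?thesis by simp
qed

lemma card_popular_pairs_power6_le:
  fixes \<delta> :: nat
  defines "n \<equiv> real (card A)" and "s \<equiv> real (card (A + A))" and "d \<equiv> real (card (popular_diffs \<delta>))"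
  shows "(n\<^sup>2 * real (card (popular_pairs \<delta>))) ^ 6 \<le> (8 * s) ^ 6 * (n ^ 3 * d ^ 5 * M ^ 3 * s ^ 4)"
proof -
  let ?D = "popular_diffs \<delta>"
  let ?V = "equal_differences A ?D popular A"
  have energy_D: "energy 3 A ?D \<le> M * d\<^sup>2"
    unfolding d_def using finite_popular_diffs by (rule energy3_le)
  have "energy 3 popular A \<le> M * (real (card popular))\<^sup>2"
    unfolding energy_commute[of 3 popular] using finite_popular by (rule energy3_le)
  also have "\<dots> \<le> M * s\<^sup>2"
    unfolding s_def using M_nonneg popular_subset finite_sumset
    by (intro mult_left_mono power_mono of_nat_mono card_mono) auto
  finally have energy_popular: "energy 3 popular A \<le> M * s\<^sup>2" .
  have "real (card ?V) ^ 6 \<le> (n * d) ^ 3 * (energy 3 A ?D * (real (energy 3 popular A))\<^sup>2)"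
    using of_nat_mono[OF card_equal_differences_power6_le
        [OF finite_A finite_popular_diffs finite_popular finite_A, of \<delta>], where 'a = real]
    by (simp add: n_def d_def)
  also have "\<dots> \<le> (n * d) ^ 3 * ((M * d\<^sup>2) * (M * s\<^sup>2)\<^sup>2)"
    using M_nonneg energy_D energy_popular
    by (intro mult_left_mono mult_mono power_mono) (auto simp: n_def d_def)
  also have "\<dots> = n ^ 3 * d ^ 5 * M ^ 3 * s ^ 4" by algebra
  finally have card_V: "real (card ?V) ^ 6 \<le> n ^ 3 * d ^ 5 * M ^ 3 * s ^ 4" .
  have "n\<^sup>2 * card (popular_pairs \<delta>) \<le> 8 * s * card ?V"
    using of_nat_mono[OF card_popular_pairs_le_card_equal_differences[of \<delta>], where 'a = real]
    by (simp add: n_def s_def)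
  then have "(n\<^sup>2 * card (popular_pairs \<delta>)) ^ 6 \<le> (8 * s * card ?V) ^ 6"
    by (rule power_mono) (simp add: n_def)
  also have "\<dots> = (8 * s) ^ 6 * real (card ?V) ^ 6" by (rule power_mult_distrib)
  also have "\<dots> \<le> (8 * s) ^ 6 * (n ^ 3 * d ^ 5 * M ^ 3 * s ^ 4)"
    using card_V by (rule mult_left_mono) (simp add: s_def)
  finally show ?thesis .
qed

theorem card_sumset_lower_bound:
  "real (card A) ^ 41
    \<le> 2 ^ 84 * real (Suc (floor_log (card A))) ^ 9 * M ^ 11 * real (card (A + A)) ^ 19"
proof -
  let ?l = "Suc (floor_log (card A))"
  obtain \<delta> where \<delta>: "card A ^ 4 \<le> 64 * card (A + A) * ?l * (card (popular_diffs \<delta>) * \<delta>\<^sup>2)"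
    by (rule obtain_dominant_popularity)
  show ?thesis
  proof (rule power41_le_of_energy_bounds)
    show "real (card A) ^ 4
        \<le> 64 * real (card (A + A)) * real ?l * (real (card (popular_diffs \<delta>)) * (real \<delta>)\<^sup>2)"
      using of_nat_mono[OF \<delta>, where 'a = real]
      by (simp only: of_nat_mult of_nat_power of_nat_numeral)
    show "0 < real (card (popular_diffs \<delta>))"
      using \<delta> card_A_pos by (cases "card (popular_diffs \<delta>) = 0") auto
    show "(real (card (popular_diffs \<delta>)) * real \<delta>)\<^sup>2 \<le> 4 * M * real (card (popular_pairs \<delta>))"
      by (rule card_popular_pairs_ge)
  qed (use card_A_pos card_sumset_pos M_nonneg card_popular_diffs_mult_power3_le
      card_popular_pairs_power6_le in auto)
qed

end

subsection \<open>Rich differences of values of a monotone grid\<close>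

locale monotone_grid =
  fixes P :: "'p set" and Q :: "'q::linorder set" and R :: "('p \<times> 'q) set"
    and g :: "'p \<Rightarrow> 'q \<Rightarrow> 'a::linordered_ab_group_add"
  assumes finite_P: "finite P" and finite_Q: "finite Q" and R_subset: "R \<subseteq> P \<times> Q"
    and row_strictly_monotone:
      "strict_mono_on (R `` {p}) (g p) \<or> strict_antimono_on (R `` {p}) (g p)"
    and column_injective: "inj_on (\<lambda>p. g p q) {p. (p, q) \<in> R}"
    and increment_determines_row:
      "\<lbrakk>(p, q) \<in> R; (p, q') \<in> R; (p', q) \<in> R; (p', q') \<in> R; q < q';
        g p q' - g p q = g p' q' - g p' q\<rbrakk> \<Longrightarrow> p = p'"
begin

definition reps :: "'a \<Rightarrow> nat" where
  "reps a = card {r \<in> R. g (fst r) (snd r) = a}"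

lemma finite_R: "finite R"
  using finite_subset[OF R_subset] finite_P finite_Q by simp

lemma row_injective: "inj_on (g p) (R `` {p})"
  using row_strictly_monotone[of p] strict_mono_iff_mono strict_antimono_iff_antimono by blast

lemma reps_le_card_P: "reps a \<le> card P"
  unfolding reps_def
proof (rule card_inj_on_le)
  show "inj_on fst {r \<in> R. g (fst r) (snd r) = a}"
    using row_injective by (auto intro!: inj_onI simp: inj_on_def)
qed (use finite_P R_subset in auto)

lemma reps_le_card_Q: "reps a \<le> card Q"
  unfolding reps_def
proof (rule card_inj_on_le)
  show "inj_on snd {r \<in> R. g (fst r) (snd r) = a}"
    using column_injective by (auto intro!: inj_onI simp: inj_on_def)
qed (use finite_Q R_subset in auto)

lemma translates_pseudoline_family:
  assumes "finite B"
  shows "pseudoline_family Q (P \<times> B) (\<lambda>c. R `` {fst c}) (\<lambda>c q. g (fst c) q - snd c)"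
proof
  fix c :: "'p \<times> 'a"
  have "mono_on (R `` {fst c}) (g (fst c)) \<or> antimono_on (R `` {fst c}) (g (fst c))"
    using row_strictly_monotone[of "fst c"] strict_mono_iff_mono strict_antimono_iff_antimono
    by blast
  then show "mono_on (R `` {fst c}) (\<lambda>q. g (fst c) q - snd c) \<or>
      antimono_on (R `` {fst c}) (\<lambda>q. g (fst c) q - snd c)"
    by (auto simp: monotone_on_def)
next
  fix c c' q q'
  assume R: "q \<in> R `` {fst c} \<inter> R `` {fst c'}" "q' \<in> R `` {fst c} \<inter> R `` {fst c'}" "q < q'"
    and eq: "g (fst c) q - snd c = g (fst c') q - snd c'"
      "g (fst c) q' - snd c = g (fst c') q' - snd c'"
  have "g (fst c) q' - g (fst c) q = (g (fst c) q' - snd c) - (g (fst c) q - snd c)" by simp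
  also have "\<dots> = g (fst c') q' - g (fst c') q" unfolding eq by simp
  finally have "fst c = fst c'"
    using R by (intro increment_determines_row[of "fst c" q q' "fst c'"]) auto
  then show "c = c'" using eq(1) by (simp add: prod_eq_iff)
qed (use finite_P finite_Q R_subset assms in auto)

lemma mult_diff_reps_le_card_translates:
  fixes T :: real
  assumes "finite A" "finite B" "\<And>a. a \<in> A \<Longrightarrow> T \<le> reps a"
  shows "T * diff_reps A B x \<le> card (SIGMA c:P \<times> B. {q \<in> R `` {fst c}. g (fst c) q - snd c = x})"
    (is "_ \<le> real (card ?J)")
proof -
  define U where "U = {u \<in> A \<times> B. fst u - snd u = x}"
  let ?V = "SIGMA u:U. {r \<in> R. g (fst r) (snd r) = fst u}"
  have finU: "finite U" using assms by (simp add: U_def)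
  have "T * diff_reps A B x = (\<Sum>u\<in>U. T)" by (simp add: U_def diff_reps_def)
  also have "\<dots> \<le> (\<Sum>u\<in>U. real (reps (fst u)))"
    using assms(3) by (intro sum_mono) (auto simp: U_def)
  also have "\<dots> = card ?V"
    unfolding reps_def using finU finite_R by simp
  also have "card ?V \<le> card ?J"
  proof (rule card_inj_on_le)
    show "inj_on (\<lambda>(u, r). ((fst r, snd u), snd r)) ?V"
      by (auto intro!: inj_onI simp: U_def)
    show "(\<lambda>(u, r). ((fst r, snd u), snd r)) ` ?V \<subseteq> ?J"
      using R_subset by (auto simp: U_def)
    show "finite ?J"
      by (rule finite_subset[of _ "(P \<times> B) \<times> Q"])
        (use finite_P finite_Q R_subset assms(2) in auto)
  qed
  finally show ?thesis by simp
qed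

lemma card_rich_differences_le:
  fixes T t :: real
  assumes "finite A" "finite B" "finite X" "0 < T" "0 < t" "card A \<le> card Q"
    and T: "\<And>a. a \<in> A \<Longrightarrow> T \<le> reps a"
    and t: "\<And>x. x \<in> X \<Longrightarrow> t \<le> diff_reps A B x"
  shows "(T * t) ^ 3 * card X \<le> 98 * (real (card P) * real (card B) * real (card Q))\<^sup>2"
proof (cases "X = {}")
  case False
  then obtain x where x: "x \<in> X" by blast
  have t_le_A: "t \<le> card A" and t_le_B: "t \<le> card B"
    using t[OF x] diff_reps_le_card_left[OF assms(1), of B x]
      diff_reps_le_card_right[OF assms(2), of A x] by linarith+
  then obtain a where a: "a \<in> A" using \<open>0 < t\<close> by fastforce
  have T_le_P: "T \<le> card P" and T_le_Q: "T \<le> card Q"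
    using T[OF a] reps_le_card_P[of a] reps_le_card_Q[of a] by linarith+
  have le_lines: "T * t \<le> card (P \<times> B)"
    unfolding card_cartesian_product of_nat_mult
    using T_le_P t_le_B assms(4,5) by (intro mult_mono) auto
  have "T * t \<le> real (card Q) * real (card Q)"
    using T_le_Q t_le_A assms(4-6) by (intro mult_mono) auto
  from mult_mono[OF le_lines this]
  have "(T * t) * (T * t) \<le> real (card (P \<times> B)) * (real (card Q) * real (card Q))"
    using assms(4,5) by simp
  then have square_le: "(T * t)\<^sup>2 \<le> real (card (P \<times> B)) * (real (card Q))\<^sup>2"
    by (simp add: power2_eq_square)
  interpret translates: pseudoline_family Q "P \<times> B" "\<lambda>c. R `` {fst c}" "\<lambda>c q. g (fst c) q - snd c"
    using assms(2) by (rule translates_pseudoline_family)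
  have "T * t \<le> card (translates.incidences {x})" if "x \<in> X" for x
  proof -
    have "T * t \<le> T * diff_reps A B x" using t[OF that] assms(4) by simp
    also have "\<dots> \<le> card (translates.incidences {x})"
      unfolding translates.incidences_def translates.incident_points_def singleton_iff
      using assms(1,2) T by (rule mult_diff_reps_le_card_translates)
    finally show ?thesis .
  qed
  then have "(T * t) ^ 3 * card X \<le> 98 * (real (card (P \<times> B)) * real (card Q))\<^sup>2"
    using assms(3-5) le_lines square_le by (intro translates.card_rich_values_le) auto
  then show ?thesis by (simp add: card_cartesian_product)
qed simp

lemma energy3_le_of_reps:
  fixes T :: real
  assumes "finite A" "finite B" "0 < T" "card A \<le> card Q" and T: "\<And>a. a \<in> A \<Longrightarrow> T \<le> reps a"
  shows "energy 3 A B
    \<le> 784 * real (Suc (floor_log (card A))) * (real (card P) * real (card Q))\<^sup>2 / T ^ 3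
      * (real (card B))\<^sup>2"
proof -
  let ?l = "real (Suc (floor_log (card A)))"
  have "diff_reps A B x \<le> card A" for x using assms(1) by (rule diff_reps_le_card_left)
  then obtain \<delta> where "0 < \<delta>" and \<delta>: "(\<Sum>x\<in>diff_set A B. diff_reps A B x ^ 3)
      \<le> Suc (floor_log (card A)) * ((2 * \<delta>) ^ 3 * card {x \<in> diff_set A B. \<delta> \<le> diff_reps A B x})"
    by (rule dyadic_pigeonhole[OF finite_diff_set[OF assms(1,2)], of _ "card A" 3]) auto
  define N where "N = real (card {x \<in> diff_set A B. \<delta> \<le> diff_reps A B x})"
  define K where "K = real (card P) * real (card B) * real (card Q)"
  have "(T * \<delta>) ^ 3 * N \<le> 98 * K\<^sup>2"
    unfolding N_def K_def using \<open>0 < \<delta>\<close> assms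
    by (intro card_rich_differences_le[of A B]) (auto simp: finite_diff_set)
  then have rich: "(2 * \<delta>) ^ 3 * N \<le> 784 * K\<^sup>2 / T ^ 3"
    using assms(3) by (simp add: field_simps power_mult_distrib)
  have "energy 3 A B \<le> ?l * ((2 * \<delta>) ^ 3 * N)"
    unfolding N_def using of_nat_mono[OF \<delta>, where 'a = real]
    by (simp only: energy_def of_nat_mult of_nat_power of_nat_numeral)
  also have "\<dots> \<le> ?l * (784 * K\<^sup>2 / T ^ 3)"
    using rich by (rule mult_left_mono) simp
  finally show ?thesis by (simp add: K_def power_mult_distrib algebra_simps)
qed

end

subsection \<open>Sumsets of sets of grid values\<close>

lemma ln_ge_1:
  fixes x :: real
  assumes "3 \<le> x" shows "1 \<le> ln x"
proof -
  have "ln 3 \<le> ln x" using assms by simp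
  then show ?thesis using ln3_gt_1 by simp
qed

lemma Suc_floor_log_le_ln:
  assumes "3 \<le> n" shows "real (Suc (floor_log n)) \<le> 3 * ln (real n)"
proof -
  have "1 \<le> ln (real n)" using assms by (intro ln_ge_1) simp
  have "real (floor_log n) \<le> log 2 (real n)"
    using assms by (simp add: floor_log_altdef le_log_of_power)
  also have "\<dots> = ln (real n) / ln 2" by (simp add: log_def)
  also have "\<dots> \<le> ln (real n) / (2 / 3)"
    using ln2_ge_two_thirds \<open>1 \<le> ln (real n)\<close> by (intro divide_left_mono) auto
  finally show ?thesis using \<open>1 \<le> ln (real n)\<close> by simp
qed

definition growth_const :: real where
  "growth_const = 2 ^ 84 * 784 ^ 11 * 3 ^ 20"

lemma growth_const_pos: "0 < growth_const"
  by (simp add: growth_const_def)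

context monotone_grid
begin

lemma card_sumset_ge:
  fixes T :: real
  assumes "finite A" "3 \<le> card A" "0 < T" "card A \<le> card Q" and T: "\<And>a. a \<in> A \<Longrightarrow> T \<le> reps a"
  shows "real (card A) ^ 41 * T ^ 33
    \<le> growth_const * ln (real (card A)) ^ 20 * (real (card P) * real (card Q)) ^ 22
      * real (card (A + A)) ^ 19"
proof -
  define l where "l = real (Suc (floor_log (card A)))"
  define K where "K = real (card P) * real (card Q)"
  define s where "s = real (card (A + A))"
  define M where "M = 784 * l * K\<^sup>2 / T ^ 3"
  interpret third_moment_bound A M
    using assms energy3_le_of_reps[OF assms(1) _ assms(3,4) T]
    by unfold_locales (auto simp: M_def l_def K_def)
  have "real (card A) ^ 41 * T ^ 33 \<le> 2 ^ 84 * l ^ 9 * M ^ 11 * s ^ 19 * T ^ 33"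
    unfolding l_def s_def using assms(3) by (intro mult_right_mono card_sumset_lower_bound) auto
  also have "\<dots> = 2 ^ 84 * l ^ 9 * (M * T ^ 3) ^ 11 * s ^ 19" by algebra
  also have "M * T ^ 3 = 784 * l * K\<^sup>2" using assms(3) by (simp add: M_def)
  also have "2 ^ 84 * l ^ 9 * (784 * l * K\<^sup>2) ^ 11 * s ^ 19
      = 2 ^ 84 * 784 ^ 11 * l ^ 20 * (K ^ 22 * s ^ 19)" by algebra
  also have "\<dots> \<le> 2 ^ 84 * 784 ^ 11 * (3 * ln (real (card A))) ^ 20 * (K ^ 22 * s ^ 19)"
    using Suc_floor_log_le_ln[OF assms(2)]
    by (intro mult_right_mono mult_left_mono power_mono) (auto simp: l_def K_def s_def)
  finally show ?thesis by (simp only: K_def s_def growth_const_def power_mult_distrib mult_ac)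
qed

end

lemma monotone_grid_times:
  fixes P Q :: "'a::linordered_idom set"
  assumes "finite P" "finite Q" "0 \<notin> P" "0 \<notin> Q"
  shows "monotone_grid P Q (P \<times> Q) (*)"
proof
  fix p :: 'a
  show "strict_mono_on ((P \<times> Q) `` {p}) ((*) p) \<or> strict_antimono_on ((P \<times> Q) `` {p}) ((*) p)"
    using assms(3) by (cases p "0::'a" rule: linorder_cases) (auto simp: monotone_on_def)
next
  fix p q p' q' :: 'a
  assume "q < q'" "p * q' - p * q = p' * q' - p' * q"
  then have "(p - p') * (q' - q) = 0" by (simp add: algebra_simps)
  with \<open>q < q'\<close> show "p = p'" by simp
qed (use assms in \<open>auto intro: inj_onI\<close>)

lemma strict_mono_on_increments:
  fixes a :: "nat \<Rightarrow> 'a::linordered_ab_group_add"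
  assumes "strict_mono_on {1..<n} (\<lambda>i. a (i + 1) - a i)" "0 < k"
  shows "strict_mono_on {1..n - k} (\<lambda>i. a (i + k) - a i)"
proof (rule strict_mono_onI)
  fix i j assume ij: "i \<in> {1..n - k}" "j \<in> {1..n - k}" "i < j"
  have "(\<Sum>t<k. a (i + Suc t) - a (i + t)) < (\<Sum>t<k. a (j + Suc t) - a (j + t))"
  proof (rule sum_strict_mono)
    fix t assume "t \<in> {..<k}"
    then show "a (i + Suc t) - a (i + t) < a (j + Suc t) - a (j + t)"
      using strict_mono_onD[OF assms(1), of "i + t" "j + t"] ij by simp
  qed (use assms(2) in auto)
  then show "a (i + k) - a i < a (j + k) - a j"
    using sum_lessThan_telescope[of "\<lambda>t. a (i + t)" k] sum_lessThan_telescope[of "\<lambda>t. a (j + t)" k]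
    by simp
qed

lemma monotone_grid_convex:
  fixes a :: "nat \<Rightarrow> 'a::linordered_ab_group_add"
  assumes mono: "strict_mono_on {1..n} a"
    and convex: "strict_mono_on {1..<n} (\<lambda>i. a (i + 1) - a i)"
  shows "monotone_grid {1..n} {1..2 * n} {(p, q). p \<in> {1..n} \<and> q \<in> {p + 1..p + n}}
    (\<lambda>p q. a (q - p))"
proof
  let ?R = "{(p, q). p \<in> {1..n} \<and> q \<in> {p + 1..p + n}}"
  fix p q p' q' :: nat
  have "strict_mono_on (?R `` {p}) (\<lambda>q. a (q - p))"
    by (rule strict_mono_onI, rule strict_mono_onD[OF mono]) auto
  then show "strict_mono_on (?R `` {p}) (\<lambda>q. a (q - p)) \<or>
      strict_antimono_on (?R `` {p}) (\<lambda>q. a (q - p))" by blast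
  show "inj_on (\<lambda>p. a (q - p)) {p. (p, q) \<in> ?R}"
  proof (rule inj_onI)
    fix p p' assume R: "p \<in> {p. (p, q) \<in> ?R}" "p' \<in> {p. (p, q) \<in> ?R}" "a (q - p) = a (q - p')"
    then have "q - p = q - p'"
      by (intro inj_onD[OF strict_mono_on_imp_inj_on[OF mono]]) auto
    then show "p = p'" using R by auto
  qed
  assume R: "(p, q) \<in> ?R" "(p, q') \<in> ?R" "(p', q) \<in> ?R" "(p', q') \<in> ?R" "q < q'"
    and eq: "a (q' - p) - a (q - p) = a (q' - p') - a (q - p')"
  have sums: "q - p + (q' - q) = q' - p" "q - p' + (q' - q) = q' - p'" using R by auto
  have "inj_on (\<lambda>i. a (i + (q' - q)) - a i) {1..n - (q' - q)}"
    using R by (intro strict_mono_on_imp_inj_on strict_mono_on_increments convex) simp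
  then have "q - p = q - p'" by (rule inj_onD) (use R eq sums in auto)
  then show "p = p'" using R by auto
qed auto

lemma card_sumset_ge_of_mult_reps:
  fixes T :: real
  assumes "finite P" "finite Q" "0 \<notin> P" "0 \<notin> Q"
    and "finite A" "3 \<le> card A" "0 < T" "card A \<le> card Q" "\<And>a. a \<in> A \<Longrightarrow> T \<le> mult_reps P Q a"
  shows "inverse growth_const * (real (card A) ^ 41 * T ^ 33 * ln (real (card A)) powi (-23))
    \<le> real (card (A + A)) ^ 19 * real (card P) ^ 22 * real (card Q) ^ 22"
proof -
  interpret monotone_grid P Q "P \<times> Q" "(*)"
    using assms(1-4) by (rule monotone_grid_times)
  have "reps a = mult_reps P Q a" for a
    unfolding reps_def mult_reps_def by (rule arg_cong[of _ _ card]) auto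
  then have "real (card A) ^ 41 * T ^ 33 \<le> growth_const * ln (real (card A)) ^ 20
      * (real (card P) * real (card Q)) ^ 22 * real (card (A + A)) ^ 19"
    using assms by (intro card_sumset_ge) auto
  also have "\<dots> \<le> growth_const * ln (real (card A)) ^ 23
      * (real (card P) * real (card Q)) ^ 22 * real (card (A + A)) ^ 19"
    using growth_const_pos ln_ge_1[of "real (card A)"] assms(6)
    by (intro mult_right_mono mult_left_mono power_increasing) auto
  finally have "real (card A) ^ 41 * T ^ 33 \<le> growth_const * ln (real (card A)) ^ 23
      * (real (card P) * real (card Q)) ^ 22 * real (card (A + A)) ^ 19" .
  moreover have "0 < ln (real (card A))" using assms(6) by simp
  ultimately show ?thesis
    using growth_const_pos by (simp add: power_int_minus field_simps power_mult_distrib)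
qed

lemma card_power30_le_of_convex:
  assumes "convex_fin_set A" "3 \<le> card A"
  shows "real (card A) ^ 30
    \<le> growth_const * 2 ^ 22 * ln (real (card A)) ^ 20 * real (card (A + A)) ^ 19"
proof -
  obtain n :: nat and a :: "nat \<Rightarrow> real" where A_eq: "A = a ` {1..n}"
    and mono: "strict_mono_on {1..n} a"
    and convex: "strict_mono_on {1..<n} (\<lambda>i. a (i + 1) - a i)"
    using assms(1) unfolding convex_fin_set_def by blast
  have card_A: "card A = n"
    unfolding A_eq using strict_mono_on_imp_inj_on[OF mono] by (simp add: card_image)
  let ?R = "{(p, q). p \<in> {1..n} \<and> q \<in> {p + 1..p + n}}"
  interpret monotone_grid "{1..n}" "{1..2 * n}" ?R "\<lambda>p q. a (q - p)"
    using mono convex by (rule monotone_grid_convex)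
  have "real n \<le> reps x" if x: "x \<in> A" for x
  proof -
    obtain i where i: "i \<in> {1..n}" "x = a i" using x A_eq by blast
    have "card {1..n} \<le> reps x"
      unfolding reps_def
    proof (rule card_inj_on_le)
      show "inj_on (\<lambda>p. (p, p + i)) {1..n}" by (rule inj_onI) simp
      show "(\<lambda>p. (p, p + i)) ` {1..n} \<subseteq> {r \<in> ?R. a (snd r - fst r) = x}" using i by auto
    qed (use finite_R in simp)
    then show ?thesis by simp
  qed
  then have "real n ^ 41 * real n ^ 33
    \<le> growth_const * ln (real n) ^ 20 * (real n * (2 * real n)) ^ 22 * real (card (A + A)) ^ 19"
    using card_sumset_ge[of A "real n"] card_A assms(2) A_eq by simp
  then have "real n ^ 44 * real n ^ 30
    \<le> real n ^ 44 * (growth_const * 2 ^ 22 * ln (real n) ^ 20 * real (card (A + A)) ^ 19)"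
    by (simp add: power_mult_distrib mult_ac flip: power_add)
  then show ?thesis
    unfolding card_A by (rule mult_left_le_imp_le) (use card_A assms(2) in simp)
qed

lemma card_sumset_ge_of_convex:
  assumes "convex_fin_set A" "3 \<le> card A"
  shows "inverse (growth_const * 2 ^ 22) powr (1 / 19)
      * (real (card A) powr (30 / 19) * ln (real (card A)) powr (- 23 / 19)) \<le> real (card (A + A))"
proof -
  define n where "n = real (card A)"
  define s where "s = real (card (A + A))"
  define C where "C = growth_const * 2 ^ 22"
  have pos: "0 < n" "0 < ln n" "0 < C"
    using assms(2) growth_const_pos by (auto simp: n_def C_def)
  have "(inverse C powr (1 / 19) * (n powr (30 / 19) * ln n powr (- 23 / 19))) ^ 19
      = inverse C * (n powr 30 * ln n powr (- 23))"
    using pos by (simp add: power_mult_distrib powr_power)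
  also have "\<dots> = n ^ 30 / (C * ln n ^ 23)"
    using pos by (simp add: powr_minus powr_numeral field_simps)
  also have "\<dots> \<le> n ^ 30 / (C * ln n ^ 20)"
    using pos ln_ge_1[of n] assms(2)
    by (intro divide_left_mono mult_left_mono power_increasing) (auto simp: n_def)
  also have "\<dots> \<le> s ^ 19"
    using card_power30_le_of_convex[OF assms] pos
    by (simp add: n_def s_def C_def pos_divide_le_eq mult_ac)
  finally show ?thesis
    unfolding n_def s_def C_def by (subst (asm) power_mono_iff) auto
qed

theorem theorem5p2:
  "(\<exists>c > (0 :: real). \<exists>N :: nat. \<forall>(A :: real set) (P1 :: real set) (P2 :: real set) (T :: real).
      finite A \<and> finite P1 \<and> finite P2 \<and> 0 \<notin> A \<and> 0 \<notin> P1 \<and> 0 \<notin> P2 \<and>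
      card A \<ge> N \<and> card P1 \<ge> card A \<and> card P2 \<ge> card A \<and>
      T \<ge> 1 \<and> (\<forall>a\<in>A. real (mult_reps P1 P2 a) \<ge> T) \<longrightarrow>
      real (card (A + A)) ^ 19 * real (card P1) ^ 22 * real (card P2) ^ 22
        \<ge> c * (real (card A) ^ 41 * T ^ 33 * ln (real (card A)) powi (-23)))
   \<and>
   (\<exists>c > (0 :: real). \<exists>N :: nat. \<forall>A :: real set.
      finite A \<and> 0 \<notin> A \<and> card A \<ge> N \<and> convex_fin_set A \<longrightarrow>
      real (card (A + A))
        \<ge> c * (real (card A) powr (30 / 19) * ln (real (card A)) powr (- 23 / 19)))"
    (is "?products \<and> ?convex")
proof (intro conjI)
  show ?products
    using growth_const_pos card_sumset_ge_of_mult_reps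
    by (intro exI[of _ "inverse growth_const"] exI[of _ 3] conjI allI impI) auto
  show ?convex
    using growth_const_pos card_sumset_ge_of_convex
    by (intro exI[of _ "inverse (growth_const * 2 ^ 22) powr (1 / 19)"] exI[of _ 3]
        conjI allI impI) auto
qed

end
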